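(* (Third law of thermodynamics) Let $S$ be the entropy of a Gibbs state $\langle\cdot\rangle$ on a Euclidean $*$-algebra $\mathbb{E}$, and let $\overline S=\langle S\rangle$. If the entropy $S$ is quantized then $\overline S\ge0$. Equality holds iff the entropy has a single level only ($|\mathcal N|=1$, where $\mathcal N$ is the index set of the levels $S_n$ of $S$).
   Context: A Euclidean $*$-algebra $\mathbb{E}$ (finite- or infinite-dimensional) is an associative complex algebra (elements are called quantities) containing the complex numbers as constants, with an involution $*$ (conjugate-linear, $(gh)^*=h^*g^*$, $g^{**}=g$, reducing to complex conjugation on constants) and a complex-valued linear integral $\int$ defined on a subspace of strongly integrable quantities (possibly extended to a larger class of integrable quantities). One writes $g\ge0$ iff $g^*=g$ and $\int h^*gh\ge0$ for all strongly integrable $h$, and $g\ge h$ iff $g-h\ge0$; $g$ is Hermitian if $g^*=g$, and bounded if $g^*g\le a^2$ for some $a\in\mathbb{R}$. For bounded $g$ and strongly integrable $h,h_l$ one assumes: (EA1) $h^*,gh,hg$ are strongly integrable; (EA2) $(\int h)^*=\int h^*$, $\int gh=\int hg$; (EA3) $\int h^*h>0$ if $h\ne0$; (EA4) $\int h^*gh=0$ for all strongly integrable $h$ implies $g=0$; (EA5) $\int h_l^*h_l\to0$ implies $\int gh_l\to0$ and $\int h_l^*gh_l\to0$; (EA6) $h_l\downarrow0$ implies $\inf\int h_l=0$, where $h_l\downarrow0$ means that for every strongly integrable $h$ the numbers $\int h^*h_lh$ are real and decrease monotonically to $0$. Examples: $\mathbb{C}^{N\times N}$ with conjugate transpose and trace;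 algebras of functions on phase space with the Liouville integral; algebras of operators on a dense subspace of a Hilbert space with the trace. The usual calculus rules for functions of quantities (exponentials, logarithms, square roots) are assumed to hold; they are automatic in finite dimension. Let $k$ be the Boltzmann constant. A Gibbs state is a mapping $\langle g\rangle:=\int e^{-S/k}g$, where the entropy $S$ is a Hermitian quantity with strongly integrable $e^{-S/k}$ and $\int e^{-S/k}=1$. A quantity $f$ is quantized iff, with a suitable spectrum $\{f_n\mid n\in\mathcal N\}$ (a family of numbers indexed by $\mathcal N$), one has $\int F(f)=\sum_{n\in\mathcal N}F(f_n)$ for all functions $F$ for which $F(f)$ is strongly integrable; the $f_n$ are then called the levels of $f$. *)

theory Defs
  imports "HOL-Analysis.Analysis" "HOL-Library.Complex_Order"
begin

text \<open>
  The order on \<^typ>\<open>complex\<close> is the one of \<^theory>\<open>HOL-Library.Complex_Order\<close>: \<open>0 \<le> z\<close> says that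
  \<open>z\<close> is real and nonnegative.

  Unital associative complex algebras with involution. The type is the set of quantities and the
  complex number \<open>c\<close> is identified with the constant \<open>c *\<^sub>C 1\<close>; this is an embedding because
  \<open>ring_1\<close> includes \<open>0 \<noteq> 1\<close>.
\<close>

class complex_star_algebra = ring_1 +
  fixes scaleC :: "complex \<Rightarrow> 'a \<Rightarrow> 'a"  (infixr "*\<^sub>C" 75)
    and star :: "'a \<Rightarrow> 'a"
  assumes scaleC_add_right: "c *\<^sub>C (g + h) = c *\<^sub>C g + c *\<^sub>C h"
    and scaleC_add_left: "(c + d) *\<^sub>C g = c *\<^sub>C g + d *\<^sub>C g"
    and scaleC_scaleC: "c *\<^sub>C (d *\<^sub>C g) = (c * d) *\<^sub>C g"
    and scaleC_one: "1 *\<^sub>C g = g"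
    and mult_scaleC_left: "(c *\<^sub>C g) * h = c *\<^sub>C (g * h)"
    and mult_scaleC_right: "g * (c *\<^sub>C h) = c *\<^sub>C (g * h)"
    and star_add: "star (g + h) = star g + star h"
    and star_scaleC: "star (c *\<^sub>C g) = cnj c *\<^sub>C star g"
    and star_mult: "star (g * h) = star h * star g"
    and star_star: "star (star g) = g"

text \<open>
  The integral is a total function in HOL, but only its values on strongly integrable quantities
  are constrained. \<open>SI_star_mult_self\<close> is tacit in the usual axioms, which apply the integral to
  \<open>h\<^sup>*h\<close> for every strongly integrable \<open>h\<close>; by polarization, products of
  strongly integrable quantities are then strongly integrable.
\<close>

class integral_star_algebra = complex_star_algebra +
  fixes strongly_integrable :: "'a set"
    and integ :: "'a \<Rightarrow> complex"
  assumes SI_zero: "0 \<in> strongly_integrable"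
    and SI_add: "g \<in> strongly_integrable \<Longrightarrow> h \<in> strongly_integrable \<Longrightarrow> g + h \<in> strongly_integrable"
    and SI_scaleC: "g \<in> strongly_integrable \<Longrightarrow> c *\<^sub>C g \<in> strongly_integrable"
    and SI_star_mult_self: "h \<in> strongly_integrable \<Longrightarrow> star h * h \<in> strongly_integrable"
    and integ_add: "g \<in> strongly_integrable \<Longrightarrow> h \<in> strongly_integrable \<Longrightarrow>
          integ (g + h) = integ g + integ h"
    and integ_scaleC: "g \<in> strongly_integrable \<Longrightarrow> integ (c *\<^sub>C g) = c * integ g"

context integral_star_algebra
begin

definition hermitian :: "'a \<Rightarrow> bool" where
  "hermitian g \<longleftrightarrow> star g = g"

definition nonneg_quantity :: "'a \<Rightarrow> bool" where
  "nonneg_quantity g \<longleftrightarrow> hermitian g \<and>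
     (\<forall>h\<in>strongly_integrable. star h * g * h \<in> strongly_integrable \<and> 0 \<le> integ (star h * g * h))"

definition bounded_quantity :: "'a \<Rightarrow> bool" where
  "bounded_quantity g \<longleftrightarrow> (\<exists>a::real. nonneg_quantity ((complex_of_real (a^2) *\<^sub>C 1) - star g * g))"

definition decreases_to_zero :: "(nat \<Rightarrow> 'a) \<Rightarrow> bool" where
  "decreases_to_zero H \<longleftrightarrow> (\<forall>h\<in>strongly_integrable.
     (\<forall>l. integ (star h * H l * h) \<in> \<real>) \<and>
     decseq (\<lambda>l. Re (integ (star h * H l * h))) \<and>
     (\<lambda>l. Re (integ (star h * H l * h))) \<longlonglongrightarrow> 0)"

end

text \<open>
  The infimum in \<open>EA6\<close> is taken in the extended reals, where it always exists; over \<^typ>\<open>real\<close> the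
  operator is unspecified for families that are not bounded below.
\<close>

class euclidean_star_algebra = integral_star_algebra +
  assumes EA1_star: "h \<in> strongly_integrable \<Longrightarrow> star h \<in> strongly_integrable"
    and EA1_left: "bounded_quantity g \<Longrightarrow> h \<in> strongly_integrable \<Longrightarrow> g * h \<in> strongly_integrable"
    and EA1_right: "bounded_quantity g \<Longrightarrow> h \<in> strongly_integrable \<Longrightarrow> h * g \<in> strongly_integrable"
    and EA2_star: "h \<in> strongly_integrable \<Longrightarrow> cnj (integ h) = integ (star h)"
    and EA2_comm: "bounded_quantity g \<Longrightarrow> h \<in> strongly_integrable \<Longrightarrow> integ (g * h) = integ (h * g)"
    and EA3: "h \<in> strongly_integrable \<Longrightarrow> h \<noteq> 0 \<Longrightarrow> 0 < integ (star h * h)"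
    and EA4: "bounded_quantity g \<Longrightarrow>
          (\<forall>h\<in>strongly_integrable. integ (star h * g * h) = 0) \<Longrightarrow> g = 0"
    and EA5: "bounded_quantity g \<Longrightarrow> (\<forall>l::nat. H l \<in> strongly_integrable) \<Longrightarrow>
          (\<lambda>l. integ (star (H l) * H l)) \<longlonglongrightarrow> 0 \<Longrightarrow>
          (\<lambda>l. integ (g * H l)) \<longlonglongrightarrow> 0 \<and> (\<lambda>l. integ (star (H l) * g * H l)) \<longlonglongrightarrow> 0"
    and EA6: "(\<forall>l::nat. H l \<in> strongly_integrable) \<Longrightarrow> decreases_to_zero H \<Longrightarrow>
          (\<forall>l. integ (H l) \<in> \<real>) \<and> (INF l. ereal (Re (integ (H l)))) = 0"

text \<open>
  The calculus of functions of quantities. \<open>fun_dom f\<close> consists of the functions \<open>F\<close> for which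
  \<open>F(f)\<close> exists in the algebra, and then \<open>fun_of F f\<close> is \<open>F(f)\<close>; elsewhere \<open>fun_of\<close> is
  unconstrained. The calculus is partial since an infinite-dimensional algebra
  need not contain \<open>F(f)\<close> for every \<open>F\<close>. The rules are required for normal \<open>f\<close> only, which
  includes the Hermitian ones: functions that depend on both \<open>z\<close> and \<open>cnj z\<close> have no consistent
  interpretation on a quantity that does not commute with its adjoint.
\<close>

class euclidean_star_algebra_calculus = euclidean_star_algebra +
  fixes fun_dom :: "'a \<Rightarrow> (complex \<Rightarrow> complex) set"
    and fun_of :: "(complex \<Rightarrow> complex) \<Rightarrow> 'a \<Rightarrow> 'a"
  assumes fun_const: "star f * f = f * star f \<Longrightarrow>
          (\<lambda>_. c) \<in> fun_dom f \<and> fun_of (\<lambda>_. c) f = c *\<^sub>C 1"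
    and fun_ident: "star f * f = f * star f \<Longrightarrow>
          (\<lambda>z. z) \<in> fun_dom f \<and> fun_of (\<lambda>z. z) f = f"
    and fun_cnj: "star f * f = f * star f \<Longrightarrow> F \<in> fun_dom f \<Longrightarrow>
          (\<lambda>z. cnj (F z)) \<in> fun_dom f \<and> fun_of (\<lambda>z. cnj (F z)) f = star (fun_of F f)"
    and fun_add: "star f * f = f * star f \<Longrightarrow> F \<in> fun_dom f \<Longrightarrow> G \<in> fun_dom f \<Longrightarrow>
          (\<lambda>z. F z + G z) \<in> fun_dom f \<and> fun_of (\<lambda>z. F z + G z) f = fun_of F f + fun_of G f"
    and fun_mult: "star f * f = f * star f \<Longrightarrow> F \<in> fun_dom f \<Longrightarrow> G \<in> fun_dom f \<Longrightarrow>
          (\<lambda>z. F z * G z) \<in> fun_dom f \<and> fun_of (\<lambda>z. F z * G z) f = fun_of F f * fun_of G f"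
    and fun_comp: "star f * f = f * star f \<Longrightarrow> G \<in> fun_dom f \<Longrightarrow> F \<in> fun_dom (fun_of G f) \<Longrightarrow>
          (\<lambda>z. F (G z)) \<in> fun_dom f \<and> fun_of (\<lambda>z. F (G z)) f = fun_of F (fun_of G f)"

context euclidean_star_algebra_calculus
begin

definition gibbs_weight :: "real \<Rightarrow> 'a \<Rightarrow> 'a" where
  "gibbs_weight k S = fun_of exp (complex_of_real (- 1 / k) *\<^sub>C S)"

definition gibbs_entropy :: "real \<Rightarrow> 'a \<Rightarrow> bool" where
  "gibbs_entropy k S \<longleftrightarrow> hermitian S \<and>
     exp \<in> fun_dom (complex_of_real (- 1 / k) *\<^sub>C S) \<and>
     gibbs_weight k S \<in> strongly_integrable \<and> integ (gibbs_weight k S) = 1"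

definition gibbs_state :: "real \<Rightarrow> 'a \<Rightarrow> 'a \<Rightarrow> complex" where
  "gibbs_state k S g = integ (gibbs_weight k S * g)"

text \<open>
  The levels are a family, so that a value may occur with multiplicity. The possibly
  infinite sum is unconditional, with convergence as part of the condition.
\<close>

definition quantized_with_levels :: "'a \<Rightarrow> 'i set \<Rightarrow> ('i \<Rightarrow> complex) \<Rightarrow> bool" where
  "quantized_with_levels f N lev \<longleftrightarrow>
     (\<forall>F\<in>fun_dom f. fun_of F f \<in> strongly_integrable \<longrightarrow>
        ((\<lambda>n. F (lev n)) has_sum integ (fun_of F f)) N)"

end

end

theory Submission
  imports Defs
begin

text \<open>
  Applying the quantization condition to \<open>|z - cnj z|\<^sup>2\<close>, which \<open>S = S\<^sup>*\<close> sends to \<open>0\<close>, forces every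
  level \<open>S\<^sub>n\<close> to be real. Applied to \<open>exp (- z / k)\<close>, it says that the positive numbers
  \<open>p\<^sub>n = exp (- S\<^sub>n / k)\<close> sum to \<open>1\<close>. Hence each \<open>p\<^sub>n \<le> 1\<close>, so \<open>S\<^sub>n \<ge> 0\<close>, and the mean entropy
  \<open>\<Sum>\<^sub>n p\<^sub>n S\<^sub>n\<close> is nonnegative. It vanishes iff all \<open>S\<^sub>n\<close> do, i.e. iff all \<open>p\<^sub>n\<close> equal \<open>1\<close>; as they sum
  to \<open>1\<close>, there is then just one of them. Conversely, a single \<open>p\<^sub>n\<close> must be \<open>1\<close>.
\<close>

lemma has_sum_nonneg_le:
  fixes f :: "'i \<Rightarrow> real"
  assumes "(f has_sum s) A" "\<And>x. x \<in> A \<Longrightarrow> f x \<ge> 0" "x \<in> A"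
  shows "f x \<le> s"
  using finite_sum_le_has_sum[OF assms(1), of "{x}"] assms(2,3) by simp

text \<open>The sum over a finite subset is its cardinality and cannot exceed the total 1, so
  \<open>A\<close> is finite. Infinite sets, to which \<open>card\<close> assigns 0, are thereby
  excluded.\<close>

lemma has_sum_one_iff_card:
  "((\<lambda>_. 1::real) has_sum 1) A \<longleftrightarrow> card A = 1"
proof
  assume sum: "((\<lambda>_. 1::real) has_sum 1) A"
  have "finite B \<and> card B \<le> 1" if "finite B" "B \<subseteq> A" for B
    using finite_sum_le_has_sum[OF sum that] that(1) by simp
  then have "finite A"
    using finite_if_finite_subsets_card_bdd by metis
  then have "((\<lambda>_. 1::real) has_sum real (card A)) A"
    using has_sum_finite[of A "\<lambda>_. 1::real"] by simp
  then show "card A = 1"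
    using has_sum_unique[OF sum] by fastforce
next
  assume "card A = 1"
  then show "((\<lambda>_. 1::real) has_sum 1) A"
    using has_sum_finite[of A "\<lambda>_. 1::real"] by (simp add: card_ge_0_finite)
qed

lemma scaleC_zero_left:
  "0 *\<^sub>C (g::'a::complex_star_algebra) = 0"
  using scaleC_add_left[of 0 0 g] by simp

lemma scaleC_minus_one: "(-1) *\<^sub>C (g::'a::complex_star_algebra) = - g"
  using scaleC_add_left[of "-1" 1 g] by (simp add: scaleC_one scaleC_zero_left add_eq_0_iff2)

lemma fun_scale:
  fixes f :: "'a::euclidean_star_algebra_calculus"
  assumes "star f * f = f * star f" "F \<in> fun_dom f"
  shows "(\<lambda>z. c * F z) \<in> fun_dom f" "fun_of (\<lambda>z. c * F z) f = c *\<^sub>C fun_of F f"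
  using fun_mult[OF assms(1) conjunct1[OF fun_const[OF assms(1), of c]] assms(2)]
    fun_const[OF assms(1), of c]
  by (simp_all add: mult_scaleC_left)

lemma quantized_has_sum:
  fixes f :: "'a::euclidean_star_algebra_calculus"
  assumes "quantized_with_levels f N lev" "F \<in> fun_dom f" "fun_of F f = g"
    "g \<in> strongly_integrable"
  shows "((\<lambda>n. F (lev n)) has_sum integ g) N"
  using assms unfolding quantized_with_levels_def by blast

lemma hermitian_levels_real:
  fixes f :: "'a::euclidean_star_algebra_calculus"
  assumes "hermitian f" "quantized_with_levels f N lev" "n \<in> N"
  shows "lev n \<in> \<real>"
proof -
  have normal: "star f * f = f * star f"
    using assms(1) by (simp add: hermitian_def)
  note id = fun_ident[OF normal]
  have cnj: "(\<lambda>z. cnj z) \<in> fun_dom f" "fun_of (\<lambda>z. cnj z) f = f"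
    using fun_cnj[OF normal conjunct1[OF id]] id assms(1) by (simp_all add: hermitian_def)
  \<comment> \<open>The difference \<open>z - cnj z\<close> is put as a sum with factor -1, since
    the calculus has rules for sums and products only.\<close>
  define D where "D = (\<lambda>z::complex. z + (-1) * cnj z)"
  have D: "D \<in> fun_dom f" "fun_of D f = 0"
    using fun_add[OF normal conjunct1[OF id] fun_scale(1)[OF normal cnj(1), of "-1"]]
      fun_scale(2)[OF normal cnj(1), of "-1"] cnj id
    unfolding D_def by (simp_all add: scaleC_minus_one)
  \<comment> \<open>Passing to the squared modulus makes the summands nonnegative, so that a
    vanishing sum forces each of them to vanish.\<close>
  define Q where "Q = (\<lambda>z. D z * cnj (D z))"
  have Q: "Q \<in> fun_dom f" "fun_of Q f = 0"
    using fun_mult[OF normal D(1) conjunct1[OF fun_cnj[OF normal D(1)]]] D(2)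
    unfolding Q_def by simp_all
  have "integ (0::'a) = 0"
    using integ_scaleC[OF SI_zero, of 0] by (simp add: scaleC_zero_left)
  then have "((\<lambda>n. Q (lev n)) has_sum 0) N"
    using quantized_has_sum[OF assms(2) Q SI_zero] by simp
  then have "((\<lambda>n. Re (Q (lev n))) has_sum Re 0) N"
    by (rule has_sum_Re)
  moreover have "Re (Q z) = (2 * Im z)\<^sup>2" for z
    by (simp add: Q_def D_def power2_eq_square)
  ultimately have "((\<lambda>n. (2 * Im (lev n))\<^sup>2) has_sum 0) N"
    by simp
  from has_sum_nonneg_le[OF this _ assms(3)] have "(2 * Im (lev n))\<^sup>2 \<le> 0"
    by simp
  then show ?thesis
    by (simp add: complex_is_Real_iff)
qed

text \<open>The weight is defined as a function of \<open>-S/k\<close>, whereas quantization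
  concerns functions of \<open>S\<close> itself; the composition rule links the two.\<close>

lemma gibbs_weight_fun_of:
  fixes S :: "'a::euclidean_star_algebra_calculus"
  assumes "gibbs_entropy k S"
  shows "(\<lambda>z. exp (complex_of_real (- 1 / k) * z)) \<in> fun_dom S"
    and "fun_of (\<lambda>z. exp (complex_of_real (- 1 / k) * z)) S = gibbs_weight k S"
proof -
  have normal: "star S * S = S * star S"
    using assms by (simp add: gibbs_entropy_def hermitian_def)
  let ?c = "complex_of_real (- 1 / k)"
  have G: "(\<lambda>z. ?c * z) \<in> fun_dom S" "fun_of (\<lambda>z. ?c * z) S = ?c *\<^sub>C S"
    using fun_scale[OF normal conjunct1[OF fun_ident[OF normal]], of ?c] fun_ident[OF normal]
    by metis+
  have "exp \<in> fun_dom (fun_of (\<lambda>z. ?c * z) S)"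
    using assms unfolding G(2) gibbs_entropy_def by blast
  from fun_comp[OF normal G(1) this]
  show "(\<lambda>z. exp (?c * z)) \<in> fun_dom S" "fun_of (\<lambda>z. exp (?c * z)) S = gibbs_weight k S"
    unfolding G(2) gibbs_weight_def by blast+
qed

theorem theorem12p2:
  fixes S :: "'a::euclidean_star_algebra_calculus"
    and k :: real
    and N :: "'i set"
    and lev :: "'i \<Rightarrow> complex"
  assumes "k > 0"
    and "gibbs_entropy k S"
    and "gibbs_weight k S * S \<in> strongly_integrable"
    and "quantized_with_levels S N lev"
  shows "0 \<le> gibbs_state k S S \<and> (gibbs_state k S S = 0 \<longleftrightarrow> card N = 1)"
proof -
  have herm: "hermitian S" and normal: "star S * S = S * star S"
    using assms(2) by (simp_all add: gibbs_entropy_def hermitian_def)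
  define s where "s = (\<lambda>n. Re (lev n))"
  define p where "p = (\<lambda>n. exp (- s n / k))"
  define E where "E = Re (gibbs_state k S S)"
  have lev: "lev n = complex_of_real (s n)" if "n \<in> N" for n
    using hermitian_levels_real[OF herm assms(4) that] by (simp add: s_def)
  let ?w = "\<lambda>z. exp (complex_of_real (- 1 / k) * z)"
  note w = gibbs_weight_fun_of[OF assms(2)]
  have w_lev: "?w (lev n) = complex_of_real (p n)" if "n \<in> N" for n
    by (simp add: lev[OF that] p_def exp_of_real flip: of_real_mult of_real_minus of_real_divide)

  have "((\<lambda>n. ?w (lev n)) has_sum 1) N"
    using quantized_has_sum[OF assms(4) w] assms(2) by (simp add: gibbs_entropy_def)
  then have "((\<lambda>n. complex_of_real (p n)) has_sum 1) N"
    by (subst (asm) has_sum_cong[OF w_lev])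
  from has_sum_Re[OF this] have sum_p: "(p has_sum 1) N"
    by simp

  \<comment> \<open>The integrand of the mean entropy is itself a function of \<open>S\<close>, so
    quantization applies to it as well.\<close>
  have wS: "(\<lambda>z. ?w z * z) \<in> fun_dom S" "fun_of (\<lambda>z. ?w z * z) S = gibbs_weight k S * S"
    using fun_mult[OF normal w(1) conjunct1[OF fun_ident[OF normal]]]
    unfolding w(2) conjunct2[OF fun_ident[OF normal]] by blast+
  have "?w (lev n) * lev n = complex_of_real (p n * s n)" if "n \<in> N" for n
    unfolding w_lev[OF that] by (simp add: lev[OF that])
  with quantized_has_sum[OF assms(4) wS assms(3)]
  have sum_S: "((\<lambda>n. complex_of_real (p n * s n)) has_sum gibbs_state k S S) N"
    unfolding gibbs_state_def by (subst (asm) has_sum_cong)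
  have sum_E: "((\<lambda>n. p n * s n) has_sum E) N"
    using has_sum_Re[OF sum_S] by (simp add: E_def)
  \<comment> \<open>The order on complex numbers includes realness, so the imaginary part of the
    mean must be shown to vanish: it is a sum of zeros.\<close>
  have "((\<lambda>n. 0::real) has_sum Im (gibbs_state k S S)) N"
    using has_sum_Im[OF sum_S] by simp
  then have state: "gibbs_state k S S = complex_of_real E"
    using has_sum_unique[OF has_sum_0_simp] by (fastforce simp: E_def complex_eq_iff)

  have p_pos: "p n > 0" for n
    by (simp add: p_def)
  have p_one_iff: "p n = 1 \<longleftrightarrow> s n = 0" for n
    using assms(1) by (simp add: p_def)
  have s_nonneg: "s n \<ge> 0" if "n \<in> N" for n
    using has_sum_nonneg_le[OF sum_p less_imp_le[OF p_pos] that] assms(1)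
    by (simp add: p_def zero_le_divide_iff)
  have term_nonneg: "p n * s n \<ge> 0" if "n \<in> N" for n
    using s_nonneg[OF that] p_pos[of n] by simp
  have "E \<ge> 0"
    using has_sum_nonneg[OF sum_E term_nonneg] .
  moreover have "E = 0 \<longleftrightarrow> card N = 1"
  proof
    assume "E = 0"
    have "p n = 1" if "n \<in> N" for n
    proof -
      \<comment> \<open>No nonnegative term exceeds the total, here 0; as \<open>p n > 0\<close>,
        this leaves \<open>s n = 0\<close>.\<close>
      have "p n * s n \<le> 0"
        using has_sum_nonneg_le[OF sum_E term_nonneg that] \<open>E = 0\<close> by simp
      then show ?thesis
        using p_pos[of n] s_nonneg[OF that] p_one_iff by (simp add: mult_le_0_iff)
    qed
    then have "((\<lambda>_. 1::real) has_sum 1) N"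
      using sum_p has_sum_cong[of N p "\<lambda>_. 1"] by blast
    then show "card N = 1"
      by (simp add: has_sum_one_iff_card)
  next
    assume "card N = 1"
    then obtain n where N: "N = {n}"
      using card_1_singletonE by blast
    have "p n = 1"
      using has_sum_unique[OF sum_p[unfolded N] has_sum_finite[of "{n}"]] by simp
    then show "E = 0"
      using has_sum_unique[OF sum_E[unfolded N] has_sum_finite[of "{n}"]] p_one_iff by simp
  qed
  ultimately show ?thesis
    by (simp add: state less_eq_complex_def)
qed

end
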